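(* Suppose $G_n$ and $C_n$ are $(K,B)$-convex and $C_n$ has the continuous order property. With $s_m$, $S_m$, $\widehat S_1<\dots<\widehat S_{w-1}$ and $s_0,s_1,\dots,s_{w-1}$ as defined in the context, the function $C_n(x)=-vx+\min\{G_n(x),\,\min_{x\le y\le x+B}G_n(y)+K\}$ takes the form $$C_n(x)=\begin{cases} K-vx+G_n(x+B) & s_{k-1}< x\leq \widehat{S}_{k}-B,\quad k=1,\ldots,w-1,\\ K-vx+G_n(\widehat{S}_k) & \widehat{S}_{k}-B< x\leq s_{k},\quad k=1,\ldots,w-1,\\ K-vx+G_n(x+B) & s_{w-1}< x\leq S_m-B,\\ K-vx+G_n(S_m) & S_m-B< x\leq s_m,\\ -vx+G_n(x) & x> s_m. \end{cases}$$
   Context: Model: a periodic-review single-item inventory system with finite horizon; periods are labelled in reverse order, so $C_n$ refers to a horizon of $n\ge 1$ periods. Demands $d_t\ge 0$ are independent, with finite mean, density $f_t$ and cumulative distribution function $F_t$. Unmet demand is backordered, lead time is zero. Parameters: fixed ordering cost $K>0$, unit ordering cost $v\ge 0$, unit holding cost $h>0$, unit shortage cost $p>0$, ordering capacity $B>0$ per period. Ordering cost: $c(0)=0$ and $c(x)=K+vx$ for $x>0$. One-period expected holding/shortage cost: $L_n(y)=\int_0^y h(y-\xi)f_n(\xi)\,d\xi+\int_y^\infty p(\xi-y)f_n(\xi)\,d\xi$ (with $f_n=0$ on negative arguments). Define $C_0\equiv 0$ and, for $n\ge1$, $$C_n(x)=\min_{x\le y\le x+B}\Big\{c(y-x)+L_n(y)+\int_0^\infty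 C_{n-1}(y-\xi)f_n(\xi)\,d\xi\Big\},\quad G_n(y)=vy+L_n(y)+\int_0^\infty C_{n-1}(y-\xi)f_n(\xi)\,d\xi.$$ A function $g$ is $(K,B)$-convex if both of the following hold: (i) $(K+g(x+a)-g(x))/a\ge (g(y)-g(y-b))/b$ for all $0<a\le B$, $0<b\le B$, $y\le x$; (ii) $(K+g(x+a)-g(x))/a\ge (K+g(y)-g(y-B))/B$ for all $0<a\le B$, $y\le x$. It is optimal to place an order at $x$ if $K+\min_{x\le y\le x+B}G_n(y)\le G_n(x)$. $C_n$ has the continuous order property if, whenever it is optimal to place an order at $x_0$, it is optimal to place an order at every $y<x_0$. $s_m$ denotes the maximum inventory level at which it is optimal to place an order, assumed to exist as a finite number, and $S_m=s_m+a$, where $0<a\le B$ is the optimal order quantity at $s_m$ (the smallest one in case of ties), i.e. $S_m$ is the smallest minimizer of $G_n$ on $[s_m,s_m+B]$. The quasiconvex envelope $\tilde g$ of $g$ on a convex set $\mathcal D\subseteq\mathbb R$ is the pointwise largest quasiconvex function that is $\le g$ on $\mathcal D$. A point $x$ is a strict local minimum from the right of $g$ if there is $\delta>0$ with $g(y)>g(x)$ for all $y\in(x,x+\delta]$. Let $[a,b]$, $a\le b$, be such that $b$ is a strict local minimum from the right, $g(x)=g(b)$ for all $x\in[a,b]$ and $g(a)=\tilde g(a)$; $[a,b]$ nontrivially belongs to the quasiconvex envelope $\tilde g$ if there is $\delta>0$ such that $g(y)>g(a)$ and $g(y)=\tilde g(y)$ for all $y\in(a-\delta,a)$. Let $\widehat{\mathcal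 S}$ be the set of all points $a$ such that some interval $[a,b]\subset(s_m,S_m)$ nontrivially belongs to the quasiconvex envelope of $G_n$ on $(s_m,S_m)$; it is taken to be a finite (possibly empty) set, enumerated as $s_m<\widehat S_1<\dots<\widehat S_{w-1}<S_m$, and $\widehat S_w=S_m$. For $k=1,\dots,w-1$ set $$b_k=\max\{b : \widehat S_k<b<\widehat S_{k+1},\ G_n(b)\ge G_n(\widehat S_k)\},\qquad s_k=b_k-B,$$ and $s_0=-\infty$.
   Formalization: Besides finiteness of the set Ŝ, it is assumed that only finitely many points b are right endpoints of intervals [a,b] belonging (even trivially) to the quasiconvex envelope of G_n on (s_m,S_m); without this, touching points accumulating at one point make the formula fail. *)

theory Defs
  imports "HOL-Probability.Probability"
begin

text \<open>
  The demand of period \<open>t\<close> is the random variable \<open>d t\<close> with density \<open>f t\<close>.  Periods are numbered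
  backwards, so \<open>N\<close> is the whole horizon and an \<open>n\<close>-period problem involves \<open>d n, \<dots>, d 1\<close>.
\<close>

locale inventory_model = prob_space M
  for M :: "'w measure" and N :: nat
    and d :: "nat \<Rightarrow> 'w \<Rightarrow> real" and f :: "nat \<Rightarrow> real \<Rightarrow> real"
    and K v h p B :: real +
  assumes fixed_cost_pos: "K > 0"
    and unit_cost_nonneg: "v \<ge> 0"
    and holding_cost_pos: "h > 0"
    and shortage_cost_pos: "p > 0"
    and capacity_pos: "B > 0"
    and demands_indep: "indep_vars (\<lambda>_. borel) d {1..N}"
    and demand_nonneg: "\<And>t \<omega>. t \<in> {1..N} \<Longrightarrow> \<omega> \<in> space M \<Longrightarrow> d t \<omega> \<ge> 0"
    and demand_finite_mean: "\<And>t. t \<in> {1..N} \<Longrightarrow> integrable M (d t)"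
    and demand_density: "\<And>t. t \<in> {1..N} \<Longrightarrow> distributed M lborel (d t) (\<lambda>x. ennreal (f t x))"
    and density_nonneg: "\<And>t x. t \<in> {1..N} \<Longrightarrow> f t x \<ge> 0"
    and density_zero_neg: "\<And>t x. t \<in> {1..N} \<Longrightarrow> x < 0 \<Longrightarrow> f t x = 0"

definition ordering_cost :: "real \<Rightarrow> real \<Rightarrow> real \<Rightarrow> real" where
  "ordering_cost K v x = (if x > 0 then K + v * x else 0)"

text \<open>
  For \<open>y < 0\<close> the set \<open>{0..y}\<close> is empty; since densities vanish on negative arguments, this
  agrees with the oriented integral from \<open>0\<close> to \<open>y\<close>.
\<close>

definition one_period_cost :: "real \<Rightarrow> real \<Rightarrow> (real \<Rightarrow> real) \<Rightarrow> real \<Rightarrow> real" where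
  "one_period_cost h p \<phi> y =
     (LINT \<xi>:{0..y}|lborel. h * (y - \<xi>) * \<phi> \<xi>) + (LINT \<xi>:{y..}|lborel. p * (\<xi> - y) * \<phi> \<xi>)"

text \<open>
  In the next definitions the minimum over \<open>x \<le> y \<le> x + B\<close> is written as an infimum.  In the
  inventory model all the functions involved are nonnegative up to a term \<open>v * y\<close> and
  lower semicontinuous, so that the infimum over the compact interval is attained.
\<close>

primrec optimal_cost ::
    "(nat \<Rightarrow> real \<Rightarrow> real) \<Rightarrow> real \<Rightarrow> real \<Rightarrow> real \<Rightarrow> real \<Rightarrow> real \<Rightarrow> nat \<Rightarrow> real \<Rightarrow> real" where
  "optimal_cost f K v h p B 0 = (\<lambda>x. 0)"
| "optimal_cost f K v h p B (Suc n) =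
     (\<lambda>x. INF y\<in>{x..x + B}. ordering_cost K v (y - x) + one_period_cost h p (f (Suc n)) y
        + (LINT \<xi>:{0..}|lborel. optimal_cost f K v h p B n (y - \<xi>) * f (Suc n) \<xi>))"

definition order_up_to_cost ::
    "(nat \<Rightarrow> real \<Rightarrow> real) \<Rightarrow> real \<Rightarrow> real \<Rightarrow> real \<Rightarrow> real \<Rightarrow> real \<Rightarrow> nat \<Rightarrow> real \<Rightarrow> real" where
  "order_up_to_cost f K v h p B n y =
     v * y + one_period_cost h p (f n) y
       + (LINT \<xi>:{0..}|lborel. optimal_cost f K v h p B (n - 1) (y - \<xi>) * f n \<xi>)"

definition KB_convex :: "real \<Rightarrow> real \<Rightarrow> (real \<Rightarrow> real) \<Rightarrow> bool" where
  "KB_convex K B g \<longleftrightarrow>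
     (\<forall>a b x y. 0 < a \<and> a \<le> B \<and> 0 < b \<and> b \<le> B \<and> y \<le> x \<longrightarrow>
        (K + g (x + a) - g x) / a \<ge> (g y - g (y - b)) / b) \<and>
     (\<forall>a x y. 0 < a \<and> a \<le> B \<and> y \<le> x \<longrightarrow>
        (K + g (x + a) - g x) / a \<ge> (K + g y - g (y - B)) / B)"

definition order_optimal :: "real \<Rightarrow> real \<Rightarrow> (real \<Rightarrow> real) \<Rightarrow> real \<Rightarrow> bool" where
  "order_optimal K B G x \<longleftrightarrow> K + (INF y\<in>{x..x + B}. G y) \<le> G x"

text \<open>
  The continuous order property of \<open>C\<^sub>n\<close> is expressed through the function \<open>G\<^sub>n\<close>, which
  determines where ordering is optimal.
\<close>

definition continuous_order_property :: "real \<Rightarrow> real \<Rightarrow> (real \<Rightarrow> real) \<Rightarrow> bool" where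
  "continuous_order_property K B G \<longleftrightarrow>
     (\<forall>x\<^sub>0. order_optimal K B G x\<^sub>0 \<longrightarrow> (\<forall>y<x\<^sub>0. order_optimal K B G y))"

definition quasiconvex_on :: "real set \<Rightarrow> (real \<Rightarrow> real) \<Rightarrow> bool" where
  "quasiconvex_on D q \<longleftrightarrow> convex D \<and>
     (\<forall>x\<in>D. \<forall>y\<in>D. \<forall>t\<in>{0..1}. q ((1 - t) * x + t * y) \<le> max (q x) (q y))"

text \<open>
  Pointwise supremum of the quasiconvex minorants; only its values on \<open>D\<close> are meaningful.
  The two lemmas below show that it is itself the largest quasiconvex minorant.
\<close>

definition quasiconvex_envelope :: "real set \<Rightarrow> (real \<Rightarrow> real) \<Rightarrow> real \<Rightarrow> real" where
  "quasiconvex_envelope D g x =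
     (SUP q\<in>{q. quasiconvex_on D q \<and> (\<forall>z\<in>D. q z \<le> g z)}. q x)"

lemma quasiconvex_envelope_upper:
  assumes "quasiconvex_on D q" "\<forall>z\<in>D. q z \<le> g z" "x \<in> D"
  shows "q x \<le> quasiconvex_envelope D g x"
  unfolding quasiconvex_envelope_def using assms
  by (intro cSUP_upper) (auto simp: bdd_above_def)

lemma quasiconvex_envelope_minorant:
  assumes "convex D" "bdd_below (g ` D)"
  shows "quasiconvex_on D (quasiconvex_envelope D g)"
    and "\<forall>x\<in>D. quasiconvex_envelope D g x \<le> g x"
proof -
  obtain c where c: "\<And>x. x \<in> D \<Longrightarrow> c \<le> g x"
    using assms(2) by (auto simp: bdd_below_def)
  let ?Q = "{q. quasiconvex_on D q \<and> (\<forall>z\<in>D. q z \<le> g z)}"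
  have "(\<lambda>_. c) \<in> ?Q" using assms(1) c by (auto simp: quasiconvex_on_def)
  then have ne: "?Q \<noteq> {}" by blast
  show "\<forall>x\<in>D. quasiconvex_envelope D g x \<le> g x"
    unfolding quasiconvex_envelope_def using ne by (auto intro!: cSUP_least)
  show "quasiconvex_on D (quasiconvex_envelope D g)"
    unfolding quasiconvex_on_def
  proof (intro conjI ballI)
    fix x y t :: real assume xy: "x \<in> D" "y \<in> D" and t: "t \<in> {0..1}"
    show "quasiconvex_envelope D g ((1 - t) * x + t * y)
        \<le> max (quasiconvex_envelope D g x) (quasiconvex_envelope D g y)"
      unfolding quasiconvex_envelope_def[of D g "(1 - t) * x + t * y"]
    proof (rule cSUP_least[OF ne])
      fix q assume q: "q \<in> ?Q"
      then have "q ((1 - t) * x + t * y) \<le> max (q x) (q y)"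
        using xy t by (auto simp: quasiconvex_on_def)
      also have "\<dots> \<le> max (quasiconvex_envelope D g x) (quasiconvex_envelope D g y)"
        using q xy by (intro max.mono quasiconvex_envelope_upper) auto
      finally show "q ((1 - t) * x + t * y)
        \<le> max (quasiconvex_envelope D g x) (quasiconvex_envelope D g y)" .
    qed
  qed (rule assms(1))
qed

definition strict_local_min_right :: "(real \<Rightarrow> real) \<Rightarrow> real \<Rightarrow> bool" where
  "strict_local_min_right g x \<longleftrightarrow> (\<exists>\<delta>>0. \<forall>y\<in>{x<..x + \<delta>}. g y > g x)"

definition belongs_to_envelope :: "real set \<Rightarrow> (real \<Rightarrow> real) \<Rightarrow> real \<Rightarrow> real \<Rightarrow> bool" where
  "belongs_to_envelope D g a b \<longleftrightarrow>
     a \<le> b \<and> {a..b} \<subseteq> D \<and> strict_local_min_right g b \<and> (\<forall>x\<in>{a..b}. g x = g b) \<and>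
     g a = quasiconvex_envelope D g a"

definition nontrivially_belongs_to_envelope ::
    "real set \<Rightarrow> (real \<Rightarrow> real) \<Rightarrow> real \<Rightarrow> real \<Rightarrow> bool" where
  "nontrivially_belongs_to_envelope D g a b \<longleftrightarrow>
     belongs_to_envelope D g a b \<and>
     (\<exists>\<delta>>0. {a - \<delta><..<a} \<subseteq> D \<and>
        (\<forall>y\<in>{a - \<delta><..<a}. g y > g a \<and> g y = quasiconvex_envelope D g y))"

end

theory Submission
  imports Defs
begin

text \<open>
  The cost \<open>C\<^sub>n\<close> is continuous with linear growth, so all minima are attained.  \<open>(K,B)\<close>-convexity at
  \<open>s\<^sub>m\<close>, where ordering is optimal, makes \<open>G\<^sub>n\<close> nonincreasing (over distances up to \<open>B\<close>) to the left
  of \<open>s\<^sub>m\<close>; hence for \<open>x \<le> s\<^sub>m < x + B \<le> S\<^sub>m\<close> the minimum over the window \<open>[x, x + B]\<close> is the running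
  minimum of \<open>G\<^sub>n\<close> over \<open>[s\<^sub>m, x + B]\<close>.  On \<open>(s\<^sub>m, S\<^sub>m)\<close> this running minimum is the quasiconvex envelope:
  if it lies below \<open>G\<^sub>n\<close> at \<open>y\<close>, then its value there was first reached at some \<open>S\<^sub>j < y\<close>.
\<close>

section \<open>Continuity of the cost functions\<close>

lemma window_inf_attained:
  fixes g :: "real \<Rightarrow> real"
  assumes "continuous_on {x..x + B} g" "0 \<le> B"
  obtains t where "x \<le> t" "t \<le> x + B" "(INF y\<in>{x..x + B}. g y) = g t"
    "\<And>z. x \<le> z \<Longrightarrow> z \<le> x + B \<Longrightarrow> g t \<le> g z"
proof -
  obtain t where t: "t \<in> {x..x + B}" "\<forall>z\<in>{x..x + B}. g t \<le> g z"
    using continuous_attains_inf[OF _ _ assms(1)] assms(2) by auto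
  moreover have "(INF y\<in>{x..x + B}. g y) = g t"
    using t by (intro cInf_eq_minimum) auto
  ultimately show ?thesis by (intro that[of t]) auto
qed

lemma window_inf_eqI:
  fixes g :: "real \<Rightarrow> real"
  assumes "x \<le> t" "t \<le> x + B" "\<And>z. x \<le> z \<Longrightarrow> z \<le> x + B \<Longrightarrow> g t \<le> g z"
  shows "(INF y\<in>{x..x + B}. g y) = g t"
  using assms by (intro cInf_eq_minimum) auto

text \<open>Windows of equal length are translates of each other: moving a minimizer of one window
  by \<open>x' - x\<close> lands in the other, and uniform continuity on a compact interval
  containing all nearby windows bounds the change of \<open>g\<close>.\<close>

lemma continuous_on_window_inf:
  fixes g :: "real \<Rightarrow> real"
  assumes cont: "continuous_on UNIV g" and B: "0 \<le> B"
  shows "continuous_on UNIV (\<lambda>x. INF y\<in>{x..x + B}. g y)"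
  unfolding continuous_on_iff
proof (intro ballI allI impI)
  fix x0 e :: real assume e: "0 < e"
  have "uniformly_continuous_on {x0 - 1..x0 + B + 1} g"
    using cont by (intro compact_uniformly_continuous) (auto intro: continuous_on_subset)
  then obtain \<delta> where \<delta>: "\<delta> > 0"
    "\<And>y z. y \<in> {x0 - 1..x0 + B + 1} \<Longrightarrow> z \<in> {x0 - 1..x0 + B + 1} \<Longrightarrow> dist z y < \<delta> \<Longrightarrow> dist (g z) (g y) < e"
    using e unfolding uniformly_continuous_on_def by metis
  have upper: "(INF y\<in>{x'..x' + B}. g y) < (INF y\<in>{x..x + B}. g y) + e"
    if "\<bar>x - x'\<bar> < \<delta>" "\<bar>x - x0\<bar> \<le> 1" "\<bar>x' - x0\<bar> \<le> 1" for x x'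
  proof -
    have c: "continuous_on A g" for A using cont by (rule continuous_on_subset) simp
    obtain t where t: "x \<le> t" "t \<le> x + B" "(INF y\<in>{x..x + B}. g y) = g t"
      using window_inf_attained[OF c B, of x] by metis
    obtain t' where t': "(INF y\<in>{x'..x' + B}. g y) = g t'"
      "\<And>z. x' \<le> z \<Longrightarrow> z \<le> x' + B \<Longrightarrow> g t' \<le> g z"
      using window_inf_attained[OF c B, of x'] by metis
    have "dist (g (t + (x' - x))) (g t) < e"
      using t that by (intro \<delta>) (auto simp: dist_real_def)
    then have "g (t + (x' - x)) < g t + e" by (auto simp: dist_real_def)
    moreover have "g t' \<le> g (t + (x' - x))" using t by (intro t') auto
    ultimately show ?thesis unfolding t(3) t'(1) by linarith
  qed
  show "\<exists>d>0. \<forall>x'\<in>UNIV. dist x' x0 < d \<longrightarrow>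
      dist (INF y\<in>{x'..x' + B}. g y) (INF y\<in>{x0..x0 + B}. g y) < e"
  proof (intro exI[of _ "min \<delta> 1"] conjI ballI impI)
    fix x' assume "dist x' x0 < min \<delta> 1"
    then have "\<bar>x' - x0\<bar> < \<delta>" "\<bar>x' - x0\<bar> \<le> 1" "\<bar>x0 - x'\<bar> < \<delta>"
      by (auto simp: dist_real_def)
    then show "dist (INF y\<in>{x'..x' + B}. g y) (INF y\<in>{x0..x0 + B}. g y) < e"
      using upper[of x' x0] upper[of x0 x'] unfolding dist_real_def by simp
  qed (use \<delta> in auto)
qed

text \<open>This growth class is stable under every operation of the cost recursion. It also makes
  costs integrable against a demand with finite mean and supplies the dominating function for
  continuity.\<close>

definition linear_growth :: "(real \<Rightarrow> real) \<Rightarrow> bool" where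
  "linear_growth g \<longleftrightarrow> (\<exists>c\<ge>0. \<forall>x. \<bar>g x\<bar> \<le> c * (1 + \<bar>x\<bar>))"

lemma linear_growthI:
  assumes "\<And>x. \<bar>g x\<bar> \<le> c * (1 + \<bar>x\<bar>)"
  shows "linear_growth g"
proof -
  have "\<bar>g x\<bar> \<le> max c 0 * (1 + \<bar>x\<bar>)" for x
    using assms[of x] mult_right_mono[of c "max c 0" "1 + \<bar>x\<bar>"] by simp
  then show ?thesis unfolding linear_growth_def by (intro exI[of _ "max c 0"]) auto
qed

lemma linear_growth_add:
  assumes "linear_growth g" "linear_growth k"
  shows "linear_growth (\<lambda>x. g x + k x)"
proof -
  obtain c c' where "\<And>x. \<bar>g x\<bar> \<le> c * (1 + \<bar>x\<bar>)" "\<And>x. \<bar>k x\<bar> \<le> c' * (1 + \<bar>x\<bar>)"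
    using assms unfolding linear_growth_def by blast
  then have "\<bar>g x + k x\<bar> \<le> c * (1 + \<bar>x\<bar>) + c' * (1 + \<bar>x\<bar>)" for x
    by (intro order_trans[OF abs_triangle_ineq] add_mono)
  then have "\<bar>g x + k x\<bar> \<le> (c + c') * (1 + \<bar>x\<bar>)" for x
    by (simp only: distrib_right)
  then show ?thesis by (rule linear_growthI)
qed

lemma linear_growth_const: "linear_growth (\<lambda>_. c)"
  by (rule linear_growthI[of _ "\<bar>c\<bar>"]) (auto simp: algebra_simps)

lemma linear_growth_mult: "linear_growth (\<lambda>x. c * x)"
  by (rule linear_growthI[of _ "\<bar>c\<bar>"]) (auto simp: algebra_simps abs_mult)

lemma linear_growth_min:
  assumes "linear_growth g" "linear_growth k"
  shows "linear_growth (\<lambda>x. min (g x) (k x))"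
proof -
  obtain c c' where *: "c \<ge> 0" "c' \<ge> 0" "\<And>x. \<bar>g x\<bar> \<le> c * (1 + \<bar>x\<bar>)" "\<And>x. \<bar>k x\<bar> \<le> c' * (1 + \<bar>x\<bar>)"
    using assms unfolding linear_growth_def by blast
  have "\<bar>min (g x) (k x)\<bar> \<le> (c + c') * (1 + \<bar>x\<bar>)" for x
  proof -
    have "0 \<le> c * (1 + \<bar>x\<bar>)" "0 \<le> c' * (1 + \<bar>x\<bar>)" using * by auto
    with *(3,4)[of x] show ?thesis unfolding distrib_right by linarith
  qed
  then show ?thesis by (rule linear_growthI)
qed

lemma linear_growth_window_inf:
  assumes "linear_growth g" "continuous_on UNIV g" "0 \<le> B"
  shows "linear_growth (\<lambda>x. INF y\<in>{x..x + B}. g y)"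
proof -
  obtain c where c: "c \<ge> 0" "\<And>x. \<bar>g x\<bar> \<le> c * (1 + \<bar>x\<bar>)"
    using assms unfolding linear_growth_def by blast
  have "\<bar>INF y\<in>{x..x + B}. g y\<bar> \<le> (c * (1 + B)) * (1 + \<bar>x\<bar>)" for x
  proof -
    obtain t where t: "x \<le> t" "t \<le> x + B" "(INF y\<in>{x..x + B}. g y) = g t"
      using window_inf_attained[OF continuous_on_subset[OF assms(2)] assms(3)] by (metis subset_UNIV)
    have "1 + \<bar>t\<bar> \<le> (1 + B) * (1 + \<bar>x\<bar>)"
    proof -
      have "0 \<le> B * \<bar>x\<bar>" using assms by simp
      moreover have "(1 + B) * (1 + \<bar>x\<bar>) = 1 + B + \<bar>x\<bar> + B * \<bar>x\<bar>" by (simp add: algebra_simps)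
      ultimately show ?thesis using t(1,2) by linarith
    qed
    then have "c * (1 + \<bar>t\<bar>) \<le> c * ((1 + B) * (1 + \<bar>x\<bar>))" using c by (intro mult_left_mono)
    with t c(2)[of t] show ?thesis unfolding mult.assoc by linarith
  qed
  then show ?thesis by (rule linear_growthI)
qed

section \<open>Regularity of the expected costs and the closed form of the recursion\<close>

context inventory_model
begin

abbreviation "cost \<equiv> optimal_cost f K v h p B"
abbreviation "target_cost \<equiv> order_up_to_cost f K v h p B"

lemma demand_measurable [measurable]: "t \<in> {1..N} \<Longrightarrow> d t \<in> borel_measurable M"
  using demand_finite_mean by (rule borel_measurable_integrable)

lemma integral_density:
  assumes t: "t \<in> {1..N}" and "g \<in> borel_measurable borel"
  shows "(LINT \<xi>|lborel. f t \<xi> * g \<xi>) = expectation (\<lambda>\<omega>. g (d t \<omega>))"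
  using assms by (intro distributed_integral[OF demand_density]) (auto simp: density_nonneg)

lemma integrable_shifted:
  assumes t: "t \<in> {1..N}" and g: "continuous_on UNIV g" "linear_growth g"
  shows "integrable M (\<lambda>\<omega>. g (y - d t \<omega>))"
proof -
  obtain c where c: "\<And>x. \<bar>g x\<bar> \<le> c * (1 + \<bar>x\<bar>)" "c \<ge> 0"
    using g unfolding linear_growth_def by blast
  have [measurable]: "g \<in> borel_measurable borel" using g(1) by (rule borel_measurable_continuous_onI)
  note [measurable] = demand_measurable[OF t]
  have "integrable M (\<lambda>\<omega>. c * (1 + \<bar>y\<bar> + \<bar>d t \<omega>\<bar>))" using demand_finite_mean[OF t] by auto
  then show ?thesis
  proof (rule Bochner_Integration.integrable_bound)
    have "\<bar>g (y - d t \<omega>)\<bar> \<le> c * (1 + \<bar>y\<bar> + \<bar>d t \<omega>\<bar>)" for \<omega>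
      using c(1)[of "y - d t \<omega>"] mult_left_mono[OF _ c(2), of "1 + \<bar>y - d t \<omega>\<bar>" "1 + \<bar>y\<bar> + \<bar>d t \<omega>\<bar>"]
      by linarith
    then show "AE \<omega> in M. norm (g (y - d t \<omega>)) \<le> norm (c * (1 + \<bar>y\<bar> + \<bar>d t \<omega>\<bar>))"
      by (intro AE_I2) (auto intro: order_trans[OF _ abs_ge_self])
  qed measurable
qed

lemma linear_growth_expectation:
  assumes t: "t \<in> {1..N}" and g: "continuous_on UNIV g" "linear_growth g"
  shows "linear_growth (\<lambda>y. expectation (\<lambda>\<omega>. g (y - d t \<omega>)))"
proof -
  obtain c where c: "\<And>x. \<bar>g x\<bar> \<le> c * (1 + \<bar>x\<bar>)" "c \<ge> 0"
    using g unfolding linear_growth_def by blast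
  let ?D = "expectation (\<lambda>\<omega>. \<bar>d t \<omega>\<bar>)"
  have D: "?D \<ge> 0" by (intro integral_nonneg_AE) auto
  have "\<bar>expectation (\<lambda>\<omega>. g (y - d t \<omega>))\<bar> \<le> (c * (1 + ?D)) * (1 + \<bar>y\<bar>)" for y
  proof -
    have "\<bar>g (y - d t \<omega>)\<bar> \<le> c * (1 + \<bar>y\<bar> + \<bar>d t \<omega>\<bar>)" for \<omega>
      using c(1)[of "y - d t \<omega>"] mult_left_mono[OF _ c(2), of "1 + \<bar>y - d t \<omega>\<bar>" "1 + \<bar>y\<bar> + \<bar>d t \<omega>\<bar>"]
      by linarith
    then have "expectation (\<lambda>\<omega>. \<bar>g (y - d t \<omega>)\<bar>) \<le> expectation (\<lambda>\<omega>. c * (1 + \<bar>y\<bar> + \<bar>d t \<omega>\<bar>))"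
      using integrable_shifted[OF t g] demand_finite_mean[OF t]
      by (intro integral_mono) auto
    also have "\<dots> = c * (1 + \<bar>y\<bar> + ?D)"
      using demand_finite_mean[OF t] by (simp add: prob_space)
    also have "\<dots> \<le> c * ((1 + ?D) * (1 + \<bar>y\<bar>))"
      using c D by (intro mult_left_mono) (auto simp: algebra_simps)
    finally show ?thesis
      using integral_abs_bound[of M "\<lambda>\<omega>. g (y - d t \<omega>)"] unfolding mult.assoc by linarith
  qed
  then show ?thesis by (rule linear_growthI)
qed

text \<open>Dominated convergence: a convergent sequence \<open>u\<close> is bounded by some
  \<open>R\<close>, so linear growth bounds all integrands by one affine function of the absolute
  demand.\<close>

lemma continuous_on_expectation:
  assumes t: "t \<in> {1..N}" and g: "continuous_on UNIV g" "linear_growth g"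
  shows "continuous_on UNIV (\<lambda>y. expectation (\<lambda>\<omega>. g (y - d t \<omega>)))"
proof (rule continuous_on_sequentiallyI)
  fix u :: "nat \<Rightarrow> real" and a assume u: "u \<longlonglongrightarrow> a"
  obtain c where c: "\<And>x. \<bar>g x\<bar> \<le> c * (1 + \<bar>x\<bar>)" "c \<ge> 0"
    using g unfolding linear_growth_def by blast
  have "Bseq u" using u convergentI convergent_imp_Bseq by blast
  then obtain R where R: "\<And>i. \<bar>u i\<bar> \<le> R" by (auto simp: Bseq_def)
  have [measurable]: "g \<in> borel_measurable borel" using g(1) by (rule borel_measurable_continuous_onI)
  note [measurable] = demand_measurable[OF t]
  show "(\<lambda>i. expectation (\<lambda>\<omega>. g (u i - d t \<omega>))) \<longlonglongrightarrow> expectation (\<lambda>\<omega>. g (a - d t \<omega>))"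
  proof (rule integral_dominated_convergence[where w = "\<lambda>\<omega>. c * (1 + R + \<bar>d t \<omega>\<bar>)"])
    show "integrable M (\<lambda>\<omega>. c * (1 + R + \<bar>d t \<omega>\<bar>))" using demand_finite_mean[OF t] by auto
    have "isCont g x" for x using g(1) by (simp add: continuous_on_eq_continuous_at)
    then show "AE \<omega> in M. (\<lambda>i. g (u i - d t \<omega>)) \<longlonglongrightarrow> g (a - d t \<omega>)"
      using u by (intro AE_I2 isCont_tendsto_compose[of _ g] tendsto_intros)
    show "AE \<omega> in M. norm (g (u i - d t \<omega>)) \<le> c * (1 + R + \<bar>d t \<omega>\<bar>)" for i
    proof (rule AE_I2)
      fix \<omega>
      have "c * (1 + \<bar>u i - d t \<omega>\<bar>) \<le> c * (1 + R + \<bar>d t \<omega>\<bar>)"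
        using c(2) R[of i] by (intro mult_left_mono) auto
      with c(1)[of "u i - d t \<omega>"] show "norm (g (u i - d t \<omega>)) \<le> c * (1 + R + \<bar>d t \<omega>\<bar>)" by simp
    qed
  qed measurable
qed

text \<open>Both integrals become expectations of a continuous function of \<open>y - d t\<close>,
  the shape required by \<open>continuous_on_expectation\<close>; this is why the shortage is
  written as \<open>- (y - d t \<omega>)\<close>.\<close>

lemma one_period_cost_eq:
  assumes t: "t \<in> {1..N}"
  shows "one_period_cost h p (f t) y =
    expectation (\<lambda>\<omega>. h * max (y - d t \<omega>) 0) + expectation (\<lambda>\<omega>. p * max (- (y - d t \<omega>)) 0)"
proof -
  have "(LINT \<xi>:{0..y}|lborel. h * (y - \<xi>) * f t \<xi>) = (LINT \<xi>|lborel. f t \<xi> * (h * max (y - \<xi>) 0))"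
    unfolding set_lebesgue_integral_def
    \<comment> \<open>The positive part also charges negative \<open>\<xi>\<close> below
      \<open>y\<close>, where the density vanishes.\<close>
    using density_zero_neg[OF t] by (intro Bochner_Integration.integral_cong) (auto simp: indicator_def max_def)
  also have "\<dots> = expectation (\<lambda>\<omega>. h * max (y - d t \<omega>) 0)"
    using t by (rule integral_density) measurable
  finally have 1: "(LINT \<xi>:{0..y}|lborel. h * (y - \<xi>) * f t \<xi>) = \<dots>" .
  have "(LINT \<xi>:{y..}|lborel. p * (\<xi> - y) * f t \<xi>) = (LINT \<xi>|lborel. f t \<xi> * (p * max (- (y - \<xi>)) 0))"
    unfolding set_lebesgue_integral_def
    by (intro Bochner_Integration.integral_cong) (auto simp: indicator_def max_def)
  also have "\<dots> = expectation (\<lambda>\<omega>. p * max (- (y - d t \<omega>)) 0)"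
    using t by (rule integral_density) measurable
  finally show ?thesis using 1 by (simp add: one_period_cost_def)
qed

lemma target_cost_regular:
  assumes t: "t \<in> {1..N}" and C: "continuous_on UNIV (cost (t - 1))" "linear_growth (cost (t - 1))"
  shows "continuous_on UNIV (target_cost t)" "linear_growth (target_cost t)"
proof -
  have [measurable]: "cost (t - 1) \<in> borel_measurable borel"
    using C(1) by (rule borel_measurable_continuous_onI)
  have "(LINT \<xi>:{0..}|lborel. cost (t - 1) (y - \<xi>) * f t \<xi>)
      = expectation (\<lambda>\<omega>. cost (t - 1) (y - d t \<omega>))" for y
  proof -
    have "(LINT \<xi>:{0..}|lborel. cost (t - 1) (y - \<xi>) * f t \<xi>)
        = (LINT \<xi>|lborel. f t \<xi> * cost (t - 1) (y - \<xi>))"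
      unfolding set_lebesgue_integral_def
      using density_zero_neg[OF t] by (intro Bochner_Integration.integral_cong) (auto simp: indicator_def)
    also have "\<dots> = expectation (\<lambda>\<omega>. cost (t - 1) (y - d t \<omega>))"
      using t by (rule integral_density) measurable
    finally show ?thesis .
  qed
  then have eq: "target_cost t = (\<lambda>y. v * y
      + (expectation (\<lambda>\<omega>. h * max (y - d t \<omega>) 0) + expectation (\<lambda>\<omega>. p * max (- (y - d t \<omega>)) 0))
      + expectation (\<lambda>\<omega>. cost (t - 1) (y - d t \<omega>)))"
    unfolding order_up_to_cost_def one_period_cost_eq[OF t] by simp
  have c: "continuous_on UNIV (\<lambda>u. h * max u 0)" "continuous_on UNIV (\<lambda>u. p * max (- u) 0)"
    by (intro continuous_intros)+
  have l: "linear_growth (\<lambda>u. h * max u 0)"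
    using holding_cost_pos by (intro linear_growthI[of _ h]) (auto simp: abs_mult)
  have l': "linear_growth (\<lambda>u. p * max (- u) 0)"
    using shortage_cost_pos by (intro linear_growthI[of _ p]) (auto simp: abs_mult)
  note ce = continuous_on_expectation[OF t c(1) l] continuous_on_expectation[OF t c(2) l']
    continuous_on_expectation[OF t C]
  note le = linear_growth_expectation[OF t c(1) l] linear_growth_expectation[OF t c(2) l']
    linear_growth_expectation[OF t C]
  show "continuous_on UNIV (target_cost t)"
    unfolding eq by (intro continuous_on_add ce continuous_on_mult continuous_on_const continuous_on_id)
  show "linear_growth (target_cost t)"
    unfolding eq by (intro linear_growth_add le linear_growth_mult)
qed

text \<open>The recursion charges \<open>K\<close> only for \<open>y > x\<close>, while the window
  here includes \<open>y = x\<close>. Since \<open>K > 0\<close>, the additional candidate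
  \<open>G x + K\<close> never beats \<open>G x\<close>. Continuity is a hypothesis because the
  formula is used inside the induction that establishes it.\<close>

lemma cost_eq_of_continuous:
  assumes t: "1 \<le> t" and cont: "continuous_on UNIV (target_cost t)"
  shows "cost t x = - v * x + min (target_cost t x) ((INF y\<in>{x..x + B}. target_cost t y) + K)"
proof -
  let ?G = "target_cost t"
  obtain m where m: "t = Suc m" using t by (cases t) auto
  have B: "0 \<le> B" using capacity_pos by simp
  obtain u where u: "x \<le> u" "u \<le> x + B" "(INF y\<in>{x..x + B}. ?G y) = ?G u"
    "\<And>z. x \<le> z \<Longrightarrow> z \<le> x + B \<Longrightarrow> ?G u \<le> ?G z"
    using window_inf_attained[OF continuous_on_subset[OF cont] B] by (metis subset_UNIV)
  let ?F = "\<lambda>y. (if y > x then K else 0) + ?G y - v * x"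
  have "cost t x = (INF y\<in>{x..x + B}. ?F y)"
    unfolding m optimal_cost.simps order_up_to_cost_def ordering_cost_def
    by (intro INF_cong) (auto simp: algebra_simps)
  also have "\<dots> = - v * x + min (?G x) (?G u + K)"
  proof (intro cInf_eq_minimum)
    show "- v * x + min (?G x) (?G u + K) \<in> ?F ` {x..x + B}"
    proof (cases "?G x \<le> ?G u + K")
      case True
      then show ?thesis using B by (intro image_eqI[of _ _ x]) auto
    next
      case False
      then have "u \<noteq> x" using fixed_cost_pos by auto
      with False u show ?thesis by (intro image_eqI[of _ _ u]) auto
    qed
    fix z assume "z \<in> ?F ` {x..x + B}"
    then obtain y where y: "x \<le> y" "y \<le> x + B" "z = ?F y" by auto
    show "- v * x + min (?G x) (?G u + K) \<le> z"
      using y u(4)[of y] by (cases "y = x") auto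
  qed
  finally show ?thesis using u by simp
qed

text \<open>The induction passes regularity from the cost of one period to the next
  \<open>target_cost\<close>, and from there through the closed form to the next cost.\<close>

lemma cost_regular:
  "t \<le> N \<Longrightarrow> continuous_on UNIV (cost t) \<and> linear_growth (cost t)"
proof (induction t)
  case 0
  show ?case by (simp add: linear_growth_const)
next
  case (Suc m)
  then have IH: "continuous_on UNIV (cost (Suc m - 1))" "linear_growth (cost (Suc m - 1))"
    and t: "Suc m \<in> {1..N}" by auto
  note G = target_cost_regular[OF t IH]
  have B: "0 \<le> B" using capacity_pos by simp
  have eq: "cost (Suc m) = (\<lambda>x. (- v) * x + min (target_cost (Suc m) x)
      ((INF y\<in>{x..x + B}. target_cost (Suc m) y) + K))"
    using cost_eq_of_continuous[OF _ G(1)] by auto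
  show ?case
    unfolding eq
    by (intro conjI continuous_on_add continuous_on_mult continuous_on_const continuous_on_id
        continuous_on_min continuous_on_window_inf linear_growth_add linear_growth_mult
        linear_growth_min linear_growth_window_inf linear_growth_const G B)
qed

lemma continuous_on_target_cost:
  assumes "1 \<le> t" "t \<le> N"
  shows "continuous_on UNIV (target_cost t)"
  using assms cost_regular[of "t - 1"] by (intro target_cost_regular(1)) auto

lemma cost_eq:
  assumes "1 \<le> t" "t \<le> N"
  shows "cost t x = - v * x + min (target_cost t x) ((INF y\<in>{x..x + B}. target_cost t y) + K)"
  using assms by (intro cost_eq_of_continuous continuous_on_target_cost) auto

end

section \<open>The quasiconvex envelope as a running minimum\<close>

lemma last_minimizer:
  fixes g :: "real \<Rightarrow> real"
  assumes co: "continuous_on {x..y} g" and "x \<le> y"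
  obtains c where "x \<le> c" "c \<le> y" "\<And>z. x \<le> z \<Longrightarrow> z \<le> y \<Longrightarrow> g c \<le> g z"
    "\<And>z. c < z \<Longrightarrow> z \<le> y \<Longrightarrow> g c < g z"
proof -
  obtain c0 where c0: "c0 \<in> {x..y}" "\<And>z. z \<in> {x..y} \<Longrightarrow> g c0 \<le> g z"
    using continuous_attains_inf[OF _ _ co] assms by auto
  let ?A = "{z \<in> {x..y}. g z = g c0}"
  have "closed ?A" by (intro continuous_closed_preimage_constant co) auto
  then have "compact ?A" unfolding compact_eq_bounded_closed by (auto intro: bounded_subset[of "{x..y}"])
  moreover have "?A \<noteq> {}" using c0 by auto
  ultimately obtain c where c: "c \<in> ?A" "\<And>z. z \<in> ?A \<Longrightarrow> z \<le> c"
    using compact_attains_sup[of ?A] by blast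
  show ?thesis
  proof (rule that[of c])
    fix z assume "c < z" "z \<le> y"
    then have "z \<in> {x..y}" "z \<notin> ?A" using c(1) c(2)[of z] by auto
    with c0(2)[of z] c(1) show "g c < g z" by (auto simp: less_eq_real_def)
  qed (use c(1) c0(2) in auto)
qed

lemma first_minimizer:
  fixes g :: "real \<Rightarrow> real"
  assumes co: "continuous_on {x..y} g" and "x \<le> y"
  obtains c where "x \<le> c" "c \<le> y" "\<And>z. x \<le> z \<Longrightarrow> z \<le> y \<Longrightarrow> g c \<le> g z"
    "\<And>z. x \<le> z \<Longrightarrow> z < c \<Longrightarrow> g c < g z"
proof -
  obtain c0 where c0: "c0 \<in> {x..y}" "\<And>z. z \<in> {x..y} \<Longrightarrow> g c0 \<le> g z"
    using continuous_attains_inf[OF _ _ co] assms by auto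
  let ?A = "{z \<in> {x..y}. g z = g c0}"
  have "closed ?A" by (intro continuous_closed_preimage_constant co) auto
  then have "compact ?A" unfolding compact_eq_bounded_closed by (auto intro: bounded_subset[of "{x..y}"])
  moreover have "?A \<noteq> {}" using c0 by auto
  ultimately obtain c where c: "c \<in> ?A" "\<And>z. z \<in> ?A \<Longrightarrow> c \<le> z"
    using compact_attains_inf[of ?A] by blast
  show ?thesis
  proof (rule that[of c])
    fix z assume "x \<le> z" "z < c"
    then have "z \<in> {x..y}" "z \<notin> ?A" using c(1) c(2)[of z] by auto
    with c0(2)[of z] c(1) show "g c < g z" by (auto simp: less_eq_real_def)
  qed (use c(1) c0(2) in auto)
qed

text \<open>Models \<open>G\<close> between \<open>s\<^sub>m\<close> and \<open>S\<^sub>m\<close>: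
  \<open>above_r\<close> comes from \<open>S\<^sub>m\<close> being the smallest minimizer,
  \<open>below_l\<close> from ordering not being optimal to the right of
  \<open>s\<^sub>m\<close>.\<close>

locale dominated_interval =
  fixes g :: "real \<Rightarrow> real" and l r :: real
  assumes l_less_r: "l < r"
    and cont: "continuous_on {l..r} g"
    and above_r: "\<And>y. l < y \<Longrightarrow> y < r \<Longrightarrow> g r < g y"
    and below_l: "\<And>y. l < y \<Longrightarrow> y < r \<Longrightarrow> g y < g l"
begin

definition running_min :: "real \<Rightarrow> bool" where
  "running_min x \<longleftrightarrow> (\<forall>z\<in>{l..x}. g x \<le> g z)"

lemma r_less_l: "g r < g l"
  using above_r[of "(l + r) / 2"] below_l[of "(l + r) / 2"] l_less_r by (simp add: field_simps)

lemma running_min_r: "running_min r"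
  unfolding running_min_def using above_r r_less_l by (metis atLeastAtMost_iff less_eq_real_def)

text \<open>The envelope lives on the open interval, so \<open>r\<close> itself cannot serve as a
  comparison point; by continuity an interior point close to \<open>r\<close> replaces it.\<close>

lemma near_r:
  assumes "x < r" "g r < m" "l \<le> x"
  obtains t where "x < t" "t < r" "g t < m"
proof -
  have "\<forall>\<^sub>F t in at r within {l..r}. g t < m"
    using cont assms l_less_r by (intro order_tendstoD) (auto simp: continuous_on_def)
  then obtain e where e: "e > 0" "\<And>t. t \<in> {l..r} \<Longrightarrow> t \<noteq> r \<Longrightarrow> dist t r < e \<Longrightarrow> g t < m"
    by (auto simp: eventually_at)
  let ?t = "max ((x + r) / 2) (r - e / 2)"
  have "x < ?t" "?t < r" "dist ?t r < e" "?t \<in> {l..r}"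
    using assms e l_less_r by (auto simp: dist_real_def max_def field_simps)
  with e(2)[of ?t] show ?thesis by (intro that[of ?t]) simp_all
qed

lemma envelope_minorant:
  "quasiconvex_on {l<..<r} (quasiconvex_envelope {l<..<r} g)"
  "\<And>x. l < x \<Longrightarrow> x < r \<Longrightarrow> quasiconvex_envelope {l<..<r} g x \<le> g x"
proof -
  have "bdd_below (g ` {l<..<r})"
    using above_r by (intro bdd_belowI[of _ "g r"]) fastforce
  from quasiconvex_envelope_minorant[OF _ this]
  show "quasiconvex_on {l<..<r} (quasiconvex_envelope {l<..<r} g)"
    "\<And>x. l < x \<Longrightarrow> x < r \<Longrightarrow> quasiconvex_envelope {l<..<r} g x \<le> g x" by auto
qed

text \<open>At a running minimum a decreasing step function is a quasiconvex minorant that touches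
  \<open>g\<close>. Conversely, a lower value before \<open>x\<close> and a lower value near
  \<open>r\<close> enclose \<open>x\<close>, and quasiconvexity pushes the envelope strictly below
  \<open>g x\<close>.\<close>

lemma eq_envelope_iff:
  assumes x: "l < x" "x < r"
  shows "g x = quasiconvex_envelope {l<..<r} g x \<longleftrightarrow> running_min x"
proof
  assume rm: "running_min x"
  \<comment> \<open>Nonincreasing in \<open>z\<close>, hence quasiconvex: a convex combination lying
    at or before \<open>x\<close> needs an endpoint at or before \<open>x\<close>.\<close>
  let ?q = "\<lambda>z. if z \<le> x then g x else g r"
  have "?q ((1 - t) * y + t * z) \<le> max (?q y) (?q z)" if "t \<in> {0..1}" for y z t
  proof -
    have "y \<le> x \<or> z \<le> x" if "(1 - t) * y + t * z \<le> x"
    proof (rule ccontr)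
      assume "\<not> (y \<le> x \<or> z \<le> x)"
      then have "y > x" "z > x" by auto
      moreover have "t > 0 \<or> 1 - t > 0" by linarith
      ultimately have "(1 - t) * (y - x) + t * (z - x) > 0"
        using \<open>t \<in> {0..1}\<close> by (auto intro: add_pos_nonneg add_nonneg_pos)
      with that show False by (simp add: algebra_simps)
    qed
    then show ?thesis using above_r[OF x] by auto
  qed
  then have "quasiconvex_on {l<..<r} ?q" by (simp add: quasiconvex_on_def)
  moreover have "\<forall>z\<in>{l<..<r}. ?q z \<le> g z"
    using rm above_r by (auto simp: running_min_def intro: less_imp_le)
  ultimately have "?q x \<le> quasiconvex_envelope {l<..<r} g x"
    by (intro quasiconvex_envelope_upper) (use x in auto)
  with envelope_minorant(2)[OF x] show "g x = quasiconvex_envelope {l<..<r} g x" by simp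
next
  let ?e = "quasiconvex_envelope {l<..<r} g"
  assume eq: "g x = ?e x"
  show "running_min x"
  proof (rule ccontr)
    assume "\<not> running_min x"
    then obtain z where z: "l \<le> z" "z \<le> x" "g z < g x" by (auto simp: running_min_def)
    \<comment> \<open>\<open>z = l\<close> is impossible because \<open>g x < g l\<close>; thus
      \<open>z\<close> lies in the domain of the envelope.\<close>
    have zx: "z < x" and lz: "l < z"
      using z below_l[OF x] by (metis less_eq_real_def less_irrefl, metis less_eq_real_def less_asym)
    obtain t where t: "x < t" "t < r" "g t < g x"
      using near_r[of x "g x"] x above_r by auto
    let ?u = "(x - z) / (t - z)"
    have "?u \<in> {0..1}" using zx t by (auto simp: field_simps)
    moreover have "x = (1 - ?u) * z + ?u * t"
    proof -
      have "?u * (t - z) = x - z" using zx t by simp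
      then show ?thesis by (simp only: algebra_simps)
    qed
    ultimately have "?e x \<le> max (?e z) (?e t)"
      using envelope_minorant(1)[unfolded quasiconvex_on_def, THEN conjunct2, rule_format, of z t ?u]
        lz zx x t by simp
    also have "\<dots> \<le> max (g z) (g t)"
      using envelope_minorant(2) lz zx x t by (intro max.mono) auto
    also have "\<dots> < g x" using z t by simp
    finally show False using eq by simp
  qed
qed

lemma cont_sub: "l \<le> x \<Longrightarrow> y \<le> r \<Longrightarrow> continuous_on {x..y} g"
  using cont by (rule continuous_on_subset) auto

text \<open>The points at which \<open>g\<close> starts to rise off its running minimum; every bump
  of \<open>g\<close> above the envelope begins at one of them.\<close>

definition turning_points :: "real set" where
  "turning_points = {c \<in> {l<..<r}. running_min c \<and> strict_local_min_right g c}"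

lemma turning_pointI:
  assumes "l < c" "c < y" "y < r" "running_min c" "\<And>z. c < z \<Longrightarrow> z \<le> y \<Longrightarrow> g c < g z"
  shows "c \<in> turning_points"
  using assms unfolding turning_points_def strict_local_min_right_def
  by (auto intro!: exI[of _ "y - c"])

text \<open>The degenerate interval from \<open>c\<close> to \<open>c\<close> belongs to the
  envelope, so finiteness of the set of right ends carries over to turning points.\<close>

lemma turning_points_subset:
  "turning_points \<subseteq> {b. \<exists>a. belongs_to_envelope {l<..<r} g a b}"
  unfolding turning_points_def belongs_to_envelope_def using eq_envelope_iff
  by (auto intro: exI[of _ c for c])

text \<open>Take the last minimizer over \<open>{l..y}\<close>. It differs from \<open>y\<close>,
  which is no running minimum, and from \<open>l\<close>, where \<open>g\<close> is larger; being
  last makes it a strict local minimum from the right.\<close>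

lemma turning_point_before:
  assumes y: "l < y" "y < r" "\<not> running_min y"
  obtains c where "c \<in> turning_points" "c < y" "\<And>z. l \<le> z \<Longrightarrow> z \<le> y \<Longrightarrow> g c \<le> g z"
proof -
  obtain c where c: "l \<le> c" "c \<le> y" "\<And>z. l \<le> z \<Longrightarrow> z \<le> y \<Longrightarrow> g c \<le> g z"
    "\<And>z. c < z \<Longrightarrow> z \<le> y \<Longrightarrow> g c < g z"
    using last_minimizer[OF cont_sub, of l y] y by auto
  have "c \<noteq> y" using c y(3) by (auto simp: running_min_def)
  moreover have "c \<noteq> l" using c(3)[of y] below_l[of y] y by auto
  moreover have "running_min c" using c by (auto simp: running_min_def)
  ultimately have "c \<in> turning_points" using c y by (intro turning_pointI[of c y]) auto
  with c \<open>c \<noteq> y\<close> show ?thesis by (intro that) auto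
qed

text \<open>Finiteness excludes bumps accumulating at either end of the first flat piece at the level of \<open>c\<close>.\<close>

lemma turning_point_imp_nontrivial:
  assumes fin: "finite turning_points" and c: "c \<in> turning_points"
  obtains a b where "nontrivially_belongs_to_envelope {l<..<r} g a b" "a \<le> c" "g a = g c"
proof -
  have lc: "l < c" "c < r" and rc: "running_min c"
    using c by (auto simp: turning_points_def)
  obtain a where a: "l \<le> a" "a \<le> c" "\<And>z. l \<le> z \<Longrightarrow> z \<le> c \<Longrightarrow> g a \<le> g z"
    "\<And>z. l \<le> z \<Longrightarrow> z < a \<Longrightarrow> g a < g z"
    using first_minimizer[OF cont_sub, of l c] lc by auto
  have gac: "g a = g c"
    using a(3)[of c] rc lc a(1,2) by (auto simp: running_min_def intro: antisym)
  have la: "l < a" using below_l[OF lc] gac a(1) by (cases "a = l") auto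
  have ra: "running_min a" using a by (auto simp: running_min_def)
  \<comment> \<open>The earliest turning point at the level of \<open>a\<close>; \<open>c\<close>
    shows that there is one.\<close>
  define b where "b = Min {t \<in> turning_points. a \<le> t \<and> g t = g a}"
  have "b \<in> {t \<in> turning_points. a \<le> t \<and> g t = g a}"
    unfolding b_def using fin c a(2) gac by (intro Min_in) auto
  then have b: "b \<in> turning_points" "a \<le> b" "g b = g a" by auto
  have b_le: "b \<le> t" if "t \<in> turning_points" "a \<le> t" "g t = g a" for t
    unfolding b_def using fin that by (intro Min_le) auto
  have lb: "l < b" "b < r" and slb: "strict_local_min_right g b" and rb: "running_min b"
    using b by (auto simp: turning_points_def)
  \<comment> \<open>A bump before \<open>b\<close> would start at the last minimizer over
    \<open>{a..y}\<close>, a turning point at the same level but earlier than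
    \<open>b\<close>.\<close>
  have flat: "g y = g b" if y: "a \<le> y" "y \<le> b" for y
  proof (rule ccontr)
    assume "g y \<noteq> g b"
    with rb y la b have gy: "g y > g a" "y < b" "a < y" by (auto simp: running_min_def less_eq_real_def)
    obtain c' where c': "a \<le> c'" "c' \<le> y" "\<And>z. a \<le> z \<Longrightarrow> z \<le> y \<Longrightarrow> g c' \<le> g z"
      "\<And>z. c' < z \<Longrightarrow> z \<le> y \<Longrightarrow> g c' < g z"
      using last_minimizer[OF cont_sub, of a y] gy la lb by auto
    have "g c' = g a"
      using c'(1,2) c'(3)[of a] gy rb la b by (auto simp: running_min_def intro!: antisym)
    moreover have "c' \<in> turning_points"
    proof (rule turning_pointI[of c' y])
      show "running_min c'" using \<open>g c' = g a\<close> rb b c' gy by (auto simp: running_min_def)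
    qed (use c' la lb gy \<open>g c' = g a\<close> in \<open>auto simp: less_eq_real_def\<close>)
    ultimately have "b \<le> c'" using b_le c' by auto
    with c' gy show False by auto
  qed
  have "belongs_to_envelope {l<..<r} g a b"
    unfolding belongs_to_envelope_def
  proof (intro conjI ballI)
    show "g a = quasiconvex_envelope {l<..<r} g a"
      using eq_envelope_iff[of a] ra la a(2) lc by simp
    show "{a..b} \<subseteq> {l<..<r}" using la lb by auto
  qed (use b(2) slb in \<open>auto intro: flat\<close>)
  moreover have "\<exists>\<delta>>0. {a - \<delta><..<a} \<subseteq> {l<..<r} \<and>
      (\<forall>y\<in>{a - \<delta><..<a}. g y > g a \<and> g y = quasiconvex_envelope {l<..<r} g y)"
  proof -
    \<comment> \<open>Its minimum \<open>\<mu>\<close> lies above \<open>g a\<close> and bounds the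
      values at all earlier turning points from below; \<open>g a + 1\<close> only keeps the set
      nonempty. Close to \<open>a\<close> the values of \<open>g\<close> drop below
      \<open>\<mu>\<close>, so no bump that began earlier can still be in progress there.\<close>
    let ?F = "insert (g a + 1) (g ` {t \<in> turning_points. t < a})"
    define \<mu> where "\<mu> = Min ?F"
    have fF: "finite ?F" using fin by auto
    have "\<mu> \<in> ?F" unfolding \<mu>_def using fF by (intro Min_in) auto
    then have \<mu>: "g a < \<mu>" using a(4) by (auto simp: turning_points_def)
    have \<mu>_le: "\<mu> \<le> g t" if "t \<in> turning_points" "t < a" for t
      unfolding \<mu>_def using fF that by (intro Min_le) auto
    have "\<forall>\<^sub>F t in at a within {l..r}. g t < \<mu>"
      using cont \<mu> a lc by (intro order_tendstoD) (auto simp: continuous_on_def)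
    then obtain e where e: "e > 0" "\<And>t. t \<in> {l..r} \<Longrightarrow> t \<noteq> a \<Longrightarrow> dist t a < e \<Longrightarrow> g t < \<mu>"
      by (auto simp: eventually_at)
    let ?\<delta> = "min e (a - l)"
    have near: "g y > g a \<and> g y = quasiconvex_envelope {l<..<r} g y" if "y \<in> {a - ?\<delta><..<a}" for y
    proof
      have y: "l < y" "y < a" "y < r" "dist y a < e" using that a lc by (auto simp: dist_real_def)
      show "g y > g a" using a y by auto
      have "running_min y"
      proof (rule ccontr)
        assume "\<not> running_min y"
        then obtain t where t: "t \<in> turning_points" "t < y" "\<And>z. l \<le> z \<Longrightarrow> z \<le> y \<Longrightarrow> g t \<le> g z"
          using turning_point_before[of y] y by blast
        have "\<mu> \<le> g y" using \<mu>_le[of t] t(1,2) t(3)[of y] y by simp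
        moreover have "g y < \<mu>" using e(2)[of y] y by auto
        ultimately show False by simp
      qed
      then show "g y = quasiconvex_envelope {l<..<r} g y" using eq_envelope_iff y by auto
    qed
    have "?\<delta> > 0" "{a - ?\<delta><..<a} \<subseteq> {l<..<r}" using e(1) la a(2) lc by auto
    with near show ?thesis by blast
  qed
  ultimately show ?thesis
    using that[of a b] a(2) gac unfolding nontrivially_belongs_to_envelope_def by blast
qed

text \<open>The last claim turns nontriviality into strictly higher running minima arbitrarily close
  to \<open>a\<close> from the left, which yields strict descent along the enumerated
  points.\<close>

lemma nontrivial_running_min:
  assumes "nontrivially_belongs_to_envelope {l<..<r} g a b"
  shows "l < a" "a < r" "running_min a"
    and "x < a \<Longrightarrow> \<exists>y\<in>{x<..<a}. l < y \<and> running_min y \<and> g a < g y"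
proof -
  have *: "a \<le> b" "{a..b} \<subseteq> {l<..<r}" "g a = quasiconvex_envelope {l<..<r} g a"
    using assms unfolding nontrivially_belongs_to_envelope_def belongs_to_envelope_def by auto
  then show la: "l < a" "a < r" by auto
  with * show "running_min a" using eq_envelope_iff by auto
  assume x: "x < a"
  obtain \<delta> where \<delta>: "\<delta> > 0" "{a - \<delta><..<a} \<subseteq> {l<..<r}"
    "\<And>y. y \<in> {a - \<delta><..<a} \<Longrightarrow> g y > g a \<and> g y = quasiconvex_envelope {l<..<r} g y"
    using assms unfolding nontrivially_belongs_to_envelope_def by blast
  obtain y where y: "max x (a - \<delta>) < y" "y < a" using dense[of "max x (a - \<delta>)" a] x \<delta>(1) by auto
  then have "y \<in> {a - \<delta><..<a}" by auto
  with y \<delta> la show "\<exists>y\<in>{x<..<a}. l < y \<and> running_min y \<and> g a < g y"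
    by (intro bexI[of _ y]) (auto simp: eq_envelope_iff subset_iff)
qed

end

section \<open>The enumerated points \<open>S k\<close> and the ends \<open>b k\<close> of the
  bumps\<close>

locale enumerated_envelope = dominated_interval +
  fixes S b :: "nat \<Rightarrow> real" and w :: nat
  assumes fin: "finite {b. \<exists>a. belongs_to_envelope {l<..<r} g a b}"
    and S_mono: "strict_mono_on {1..<w} S"
    and S_enum: "S ` {1..<w} = {a. \<exists>b. nontrivially_belongs_to_envelope {l<..<r} g a b}"
    and S_w: "S w = r"
    and b: "\<And>k. k \<in> {1..<w} \<Longrightarrow> b k = (GREATEST x. S k < x \<and> x < S (k + 1) \<and> g x \<ge> g (S k))"
begin

lemma S_nontrivial:
  assumes "k \<in> {1..<w}"
  obtains e where "nontrivially_belongs_to_envelope {l<..<r} g (S k) e"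
  using assms S_enum by blast

lemma S_bounds:
  assumes "k \<in> {1..<w}"
  shows "l < S k" "S k < r" "running_min (S k)"
  using S_nontrivial[OF assms] nontrivial_running_min(1-3) by metis+

lemma S_less:
  assumes "1 \<le> i" "i < j" "j \<le> w"
  shows "S i < S j"
proof (cases "j = w")
  case True
  then show ?thesis using S_bounds[of i] S_w assms by auto
next
  case False
  then show ?thesis using assms by (intro strict_mono_onD[OF S_mono]) auto
qed

lemma S_le:
  assumes "1 \<le> i" "i \<le> j" "j \<le> w"
  shows "S i \<le> S j"
  using S_less[of i j] assms by (cases "i = j") auto

text \<open>A turning point need not be an enumerated point itself, but the first point at its level
  is.\<close>

lemma S_before:
  assumes "l < y" "y < r" "\<not> running_min y"
  obtains j where "j \<in> {1..<w}" "S j < y" "\<And>z. l \<le> z \<Longrightarrow> z \<le> y \<Longrightarrow> g (S j) \<le> g z"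
proof -
  obtain c where c: "c \<in> turning_points" "c < y" "\<And>z. l \<le> z \<Longrightarrow> z \<le> y \<Longrightarrow> g c \<le> g z"
    using turning_point_before assms by blast
  have "finite turning_points" using turning_points_subset fin by (rule finite_subset)
  then obtain a e where ab: "nontrivially_belongs_to_envelope {l<..<r} g a e" "a \<le> c" "g a = g c"
    using turning_point_imp_nontrivial c by blast
  then obtain j where "j \<in> {1..<w}" "a = S j" using S_enum by blast
  with c ab show ?thesis by (intro that[of j]) auto
qed

text \<open>For an interior \<open>S (k + 1)\<close>, nontriviality gives a running minimum between
  \<open>S k\<close> and \<open>S (k + 1)\<close> that is strictly higher than the latter; being a
  running minimum it is at most \<open>g (S k)\<close>.\<close>

lemma S_Suc_lower:
  assumes k: "k \<in> {1..<w}"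
  shows "g (S (k + 1)) < g (S k)"
proof (cases "k + 1 = w")
  case True
  then show ?thesis using S_bounds[OF k] above_r S_w by auto
next
  case False
  then have k1: "k + 1 \<in> {1..<w}" using k by auto
  have "S k < S (k + 1)" using S_less[of k "k + 1"] k by auto
  then obtain y where y: "S k < y" "running_min y" "g (S (k + 1)) < g y"
    using S_nontrivial[OF k1] nontrivial_running_min(4) by (metis greaterThanLessThan_iff)
  then have "g y \<le> g (S k)" using S_bounds[OF k] by (auto simp: running_min_def)
  with y show ?thesis by simp
qed

text \<open>\<open>GREATEST\<close> is meaningful only once a maximum exists. The flat piece at
  \<open>S k\<close> ends before \<open>S (k + 1)\<close> and \<open>g\<close> rises after it, so
  candidates exist; the strictly lower value at \<open>S (k + 1)\<close> keeps their supremum away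
  from that open end.\<close>

lemma b_greatest:
  assumes k: "k \<in> {1..<w}"
  shows "S k < b k" "b k < S (k + 1)" "g (S k) \<le> g (b k)"
    and "\<And>y. b k < y \<Longrightarrow> y < S (k + 1) \<Longrightarrow> g y < g (S k)"
proof -
  let ?P = "\<lambda>x. S k < x \<and> x < S (k + 1) \<and> g (S k) \<le> g x"
  note Sk = S_bounds[OF k]
  have S1: "S k < S (k + 1)" "S (k + 1) \<le> r"
    using S_less[of k "k + 1"] S_le[of "k + 1" w] S_w k by auto
  obtain c where c: "nontrivially_belongs_to_envelope {l<..<r} g (S k) c"
    using S_nontrivial[OF k] .
  then have c': "S k \<le> c" "{S k..c} \<subseteq> {l<..<r}" "strict_local_min_right g c"
      and "\<forall>x\<in>{S k..c}. g x = g c"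
    unfolding nontrivially_belongs_to_envelope_def belongs_to_envelope_def by blast+
  then have flat: "g x = g c" if "S k \<le> x" "x \<le> c" for x
    using that by (meson atLeastAtMost_iff)
  have "c < S (k + 1)"
  proof (rule ccontr)
    assume "\<not> c < S (k + 1)"
    then have "g (S (k + 1)) = g (S k)" using flat[of "S (k + 1)"] flat[of "S k"] S1 by simp
    with S_Suc_lower[OF k] show False by simp
  qed
  obtain \<delta> where \<delta>: "\<delta> > 0" "\<And>y. c < y \<Longrightarrow> y \<le> c + \<delta> \<Longrightarrow> g c < g y"
    using c'(3) by (auto simp: strict_local_min_right_def)
  obtain x0 where x0: "c < x0" "x0 < min (c + \<delta>) (S (k + 1))"
    using dense[of c "min (c + \<delta>) (S (k + 1))"] \<delta>(1) \<open>c < S (k + 1)\<close> by auto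
  then have g0: "g (S k) \<le> g x0" using \<delta>(2)[of x0] flat[of "S k"] c'(1) by simp
  \<comment> \<open>Closing the range at \<open>S (k + 1)\<close> gives compactness, and starting at
    \<open>x0\<close> excludes \<open>S k\<close>.\<close>
  let ?A = "{x \<in> {x0..S (k + 1)}. g (S k) \<le> g x}"
  have co: "continuous_on {x0..S (k + 1)} g"
    by (rule cont_sub) (use Sk(1) S1(2) x0(1) c'(1) in auto)
  have "closed ?A"
  proof -
    have "?A = {x0..S (k + 1)} \<inter> g -` {g (S k)..}" by auto
    then show ?thesis using continuous_closed_preimage[OF co, of "{g (S k)..}"] by simp
  qed
  then have "compact ?A" unfolding compact_eq_bounded_closed by (auto intro: bounded_subset[of "{x0..S (k + 1)}"])
  moreover have "x0 \<in> ?A" using x0 g0 by auto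
  ultimately obtain m where m: "m \<in> ?A" "\<And>z. z \<in> ?A \<Longrightarrow> z \<le> m"
    using compact_attains_sup[of ?A] by blast
  have "m \<noteq> S (k + 1)" using m(1) S_Suc_lower[OF k] by auto
  then have Pm: "?P m" using m(1) x0 c'(1) by auto
  have max: "y \<le> m" if "?P y" for y
    using that m(2)[of y] m(1) by (cases "y \<ge> x0") auto
  have "b k = m" unfolding b[OF k] using Pm max by (intro Greatest_equality) auto
  with Pm show bk: "S k < b k" "b k < S (k + 1)" "g (S k) \<le> g (b k)" by auto
  show "g y < g (S k)" if "b k < y" "y < S (k + 1)" for y
    using max[of y] that bk(1) \<open>b k = m\<close> by (intro ccontr[of "g y < g (S k)"]) auto
qed

text \<open>If \<open>y\<close> were no running minimum, some \<open>S j\<close> before it would be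
  at least as low, with \<open>j \<le> k - 1\<close>. But past \<open>b (k - 1)\<close> the values
  are below \<open>g (S (k - 1))\<close>, which is at most \<open>g (S j)\<close>. For
  \<open>k = 1\<close> no such \<open>j\<close> exists.\<close>

lemma descending_piece:
  assumes k: "k \<in> {1..w}" and y: "l < y" "y \<le> S k" and after: "k \<ge> 2 \<Longrightarrow> b (k - 1) < y"
  shows "running_min y"
proof (cases "y = S k")
  case True
  then show ?thesis using S_bounds(3)[of k] k S_w running_min_r by (cases "k = w") auto
next
  case False
  then have yk: "y < S k" using y by simp
  then have "y < r" using S_le[of k w] k S_w by auto
  show ?thesis
  proof (rule ccontr)
    assume "\<not> running_min y"
    then obtain j where j: "j \<in> {1..<w}" "S j < y" "\<And>z. l \<le> z \<Longrightarrow> z \<le> y \<Longrightarrow> g (S j) \<le> g z"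
      using S_before[OF y(1) \<open>y < r\<close>] by blast
    have "j < k" using S_le[of k j] j k yk by force
    then have k1: "k - 1 \<in> {1..<w}" "j \<le> k - 1" and k2: "k \<ge> 2" using j k by auto
    have "g y < g (S (k - 1))" using b_greatest(4)[OF k1(1), of y] after yk k2 by auto
    also have "\<dots> \<le> g (S j)"
      using S_bounds(3)[OF k1(1)] S_bounds(1)[OF j(1)] S_le[of j "k - 1"] k1 j(1)
      by (auto simp: running_min_def)
    also have "\<dots> \<le> g y" using j(3) y by auto
    finally show False by simp
  qed
qed

text \<open>A lower value before \<open>b k\<close> would mean that \<open>b k\<close> is no running
  minimum, so some \<open>S j\<close> before it minimizes \<open>g\<close> over
  \<open>{l..b k}\<close>. Then \<open>j \<le> k\<close>, and \<open>S k\<close> is at least as low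
  as \<open>S j\<close>.\<close>

lemma flat_piece:
  assumes k: "k \<in> {1..<w}" and z: "l \<le> z" "z \<le> b k"
  shows "g (S k) \<le> g z"
proof (rule ccontr)
  assume less: "\<not> g (S k) \<le> g z"
  note bk = b_greatest[OF k] and Sk = S_bounds[OF k]
  have br: "b k < r" using bk S_le[of "k + 1" w] S_w k by auto
  have "\<not> g (b k) \<le> g z" using less bk(3) by simp
  then have "\<not> running_min (b k)" using z by (auto simp: running_min_def)
  then obtain j where j: "j \<in> {1..<w}" "S j < b k" "\<And>z. l \<le> z \<Longrightarrow> z \<le> b k \<Longrightarrow> g (S j) \<le> g z"
    using S_before[of "b k"] br bk Sk by auto
  have "j \<le> k" using S_le[of "k + 1" j] j k bk by force
  then have "g (S k) \<le> g (S j)"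
    using Sk(3) S_bounds(1)[OF j(1)] S_le[of j k] k j(1) by (auto simp: running_min_def)
  also have "\<dots> \<le> g z" using j(3) z by auto
  finally show False using less by simp
qed

end

section \<open>Ordering left of \<open>s\<^sub>m\<close>\<close>

text \<open>With step \<open>S - s\<close> at \<open>s\<close>, the forward quotient in the first
  convexity inequality is nonpositive because ordering up to \<open>S\<close> pays off; it bounds
  all backward slopes to the left of \<open>s\<close>.\<close>

lemma KB_convex_nonincreasing:
  assumes conv: "KB_convex K B g" and order: "s < S" "S \<le> s + B" "K + g S \<le> g s"
    and xy: "x \<le> y" "y \<le> s" "y - x \<le> B"
  shows "g y \<le> g x"
proof (cases "x = y")
  case False
  have "(K + g (s + (S - s)) - g s) / (S - s) \<ge> (g y - g (y - (y - x))) / (y - x)"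
    using conv[unfolded KB_convex_def, THEN conjunct1, rule_format, of "S - s" "y - x" y s]
      order xy False by simp
  moreover have "(K + g (s + (S - s)) - g s) / (S - s) \<le> 0"
    using order by (intro divide_nonpos_pos) auto
  ultimately have "(g y - g x) / (y - x) \<le> 0" by simp
  with xy False show ?thesis by (simp add: divide_le_0_iff)
qed simp

section \<open>Assembling the pieces of the cost function\<close>

theorem lemma14:
  fixes M :: "'w measure" and N n w :: nat
    and d :: "nat \<Rightarrow> 'w \<Rightarrow> real" and f :: "nat \<Rightarrow> real \<Rightarrow> real"
    and K v h p B s\<^sub>m S\<^sub>m :: real
    and C G :: "real \<Rightarrow> real" and S b :: "nat \<Rightarrow> real" and s :: "nat \<Rightarrow> ereal"
  assumes model: "inventory_model M N d f K v h p B"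
    and n: "1 \<le> n" "n \<le> N"
    and C: "C = optimal_cost f K v h p B n"
    and G: "G = order_up_to_cost f K v h p B n"
    and G_convex: "KB_convex K B G"
    and C_convex: "KB_convex K B C"
    and cop: "continuous_order_property K B G"
    and s\<^sub>m: "order_optimal K B G s\<^sub>m" "\<forall>x. order_optimal K B G x \<longrightarrow> x \<le> s\<^sub>m"
    and S\<^sub>m: "S\<^sub>m = (LEAST y. is_arg_min G (\<lambda>y. y \<in> {s\<^sub>m..s\<^sub>m + B}) y)"
    and fin: "finite {b. \<exists>a. belongs_to_envelope {s\<^sub>m<..<S\<^sub>m} G a b}"
    and w: "1 \<le> w"
    and S_mono: "strict_mono_on {1..<w} S"
    and S_enum: "S ` {1..<w} = {a. \<exists>b. nontrivially_belongs_to_envelope {s\<^sub>m<..<S\<^sub>m} G a b}"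
    and S_w: "S w = S\<^sub>m"
    and b: "\<forall>k\<in>{1..<w}. b k = (GREATEST x. S k < x \<and> x < S (k + 1) \<and> G x \<ge> G (S k))"
    and s_0: "s 0 = - \<infinity>"
    and s: "\<forall>k\<in>{1..<w}. s k = ereal (b k - B)"
  shows "(\<forall>x. C x = - v * x + min (G x) ((INF y\<in>{x..x + B}. G y) + K)) \<and>
    (\<forall>k\<in>{1..<w}. \<forall>x. s (k - 1) < ereal x \<and> x \<le> S k - B \<longrightarrow> C x = K - v * x + G (x + B)) \<and>
    (\<forall>k\<in>{1..<w}. \<forall>x. S k - B < x \<and> ereal x \<le> s k \<longrightarrow> C x = K - v * x + G (S k)) \<and>
    (\<forall>x. s (w - 1) < ereal x \<and> x \<le> S\<^sub>m - B \<longrightarrow> C x = K - v * x + G (x + B)) \<and>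
    (\<forall>x. S\<^sub>m - B < x \<and> x \<le> s\<^sub>m \<longrightarrow> C x = K - v * x + G S\<^sub>m) \<and>
    (\<forall>x. x > s\<^sub>m \<longrightarrow> C x = - v * x + G x)"
proof -
  interpret inventory_model M N d f K v h p B by (rule model)
  have B0: "0 < B" and K0: "0 < K" by (rule capacity_pos fixed_cost_pos)+
  have cont: "continuous_on A G" for A
    unfolding G using continuous_on_target_cost[OF n] by (rule continuous_on_subset) simp
  have C_eq: "C x = - v * x + min (G x) ((INF y\<in>{x..x + B}. G y) + K)" for x
    unfolding C G by (rule cost_eq[OF n])
  have inf_le: "(INF y\<in>{x..x + B}. G y) \<le> G z" if z: "x \<le> z" "z \<le> x + B" for x z
  proof -
    obtain t where "(INF y\<in>{x..x + B}. G y) = G t" "\<And>z. x \<le> z \<Longrightarrow> z \<le> x + B \<Longrightarrow> G t \<le> G z"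
      using window_inf_attained[OF cont less_imp_le[OF B0], of x] by blast
    with z show ?thesis by simp
  qed

  obtain t where t: "s\<^sub>m \<le> t" "t \<le> s\<^sub>m + B" "\<And>z. s\<^sub>m \<le> z \<Longrightarrow> z \<le> s\<^sub>m + B \<Longrightarrow> G t \<le> G z"
    "\<And>z. s\<^sub>m \<le> z \<Longrightarrow> z < t \<Longrightarrow> G t < G z"
    using first_minimizer[OF cont, of s\<^sub>m "s\<^sub>m + B"] B0 by auto
  have "S\<^sub>m = t"
    unfolding S\<^sub>m
  proof (rule Least_equality)
    show "is_arg_min G (\<lambda>y. y \<in> {s\<^sub>m..s\<^sub>m + B}) t"
      using t by (auto simp: is_arg_min_def not_less)
    show "t \<le> y" if "is_arg_min G (\<lambda>y. y \<in> {s\<^sub>m..s\<^sub>m + B}) y" for y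
      using that t(1,2) t(4)[of y] unfolding is_arg_min_def by force
  qed
  note Sm = t[folded this]
  have "(INF y\<in>{s\<^sub>m..s\<^sub>m + B}. G y) = G S\<^sub>m" using Sm by (intro window_inf_eqI)
  with s\<^sub>m(1) have opt: "K + G S\<^sub>m \<le> G s\<^sub>m" by (simp add: order_optimal_def)
  have less: "s\<^sub>m < S\<^sub>m" using Sm(1) opt K0 by (cases "s\<^sub>m = S\<^sub>m") auto
  have not_opt: "G x < K + (INF y\<in>{x..x + B}. G y)" if "s\<^sub>m < x" for x
    using s\<^sub>m(2) that unfolding order_optimal_def by (metis not_le)
  \<comment> \<open>\<open>S\<^sub>m\<close> is still in the window of \<open>y\<close>, so not
    ordering at \<open>y\<close> gives \<open>G y < K + G S\<^sub>m\<close>, which is at most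
    \<open>G s\<^sub>m\<close>.\<close>
  have below: "G y < G s\<^sub>m" if y: "s\<^sub>m < y" "y \<le> S\<^sub>m" for y
    using not_opt[OF y(1)] inf_le[of y S\<^sub>m] y Sm(2) opt by linarith
  interpret enumerated_envelope G s\<^sub>m S\<^sub>m S b w
    using less Sm below fin S_mono S_enum S_w b by unfold_locales (auto intro: cont)

  have C_right: "C x = - v * x + G x" if "s\<^sub>m < x" for x
    using C_eq[of x] not_opt[OF that] by simp
  \<comment> \<open>By the continuous order property ordering is optimal at every
    \<open>x \<le> s\<^sub>m\<close>, so it remains to locate a minimizer of the window.\<close>
  have C_left: "C x = K - v * x + G y"
    if x: "x \<le> s\<^sub>m" and y: "x \<le> y" "y \<le> x + B" and min: "\<And>z. x \<le> z \<Longrightarrow> z \<le> x + B \<Longrightarrow> G y \<le> G z" for x y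
  proof -
    have "order_optimal K B G x"
      using cop s\<^sub>m(1) x unfolding continuous_order_property_def by (cases "x = s\<^sub>m") auto
    then have "K + (INF y\<in>{x..x + B}. G y) \<le> G x" by (simp add: order_optimal_def)
    moreover have "(INF y\<in>{x..x + B}. G y) = G y" using y min by (rule window_inf_eqI)
    ultimately show ?thesis using C_eq[of x] by simp
  qed
  have nonincr: "G y \<le> G x" if "x \<le> y" "y \<le> s\<^sub>m" "y - x \<le> B" for x y
    using KB_convex_nonincreasing[OF G_convex less Sm(2) opt that] .
  text \<open>Left of \<open>s\<^sub>m\<close> the function \<open>G\<close> does not increase, so only the part of the window beyond \<open>s\<^sub>m\<close> matters.\<close>
  have window_min: "G y \<le> G z"
    if "x \<le> s\<^sub>m" "s\<^sub>m \<le> x + B" "\<And>z. s\<^sub>m \<le> z \<Longrightarrow> z \<le> x + B \<Longrightarrow> G y \<le> G z" "x \<le> z" "z \<le> x + B" for x y z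
    using that(1,2,4,5) that(3)[of z] that(3)[of s\<^sub>m] nonincr[of z s\<^sub>m] by linarith

  \<comment> \<open>Admitting \<open>k = w\<close> covers the third line of the formula as well,
    since \<open>S w = S\<^sub>m\<close>.\<close>
  have descending: "C x = K - v * x + G (x + B)"
    if k: "k \<in> {1..w}" and x: "s (k - 1) < ereal x" "x \<le> S k - B" for k x
  proof -
    have Sk: "S k \<le> S\<^sub>m" using S_le[of k w] S_w k by simp
    then have xs: "x \<le> s\<^sub>m" using x(2) Sm(2) by simp
    have "G (x + B) \<le> G z" if z: "x \<le> z" "z \<le> x + B" for z
    proof (cases "x + B \<le> s\<^sub>m")
      case True
      with z show ?thesis by (intro nonincr) auto
    next
      case False
      \<comment> \<open>The threshold is \<open>b (k - 1)\<close> shifted by \<open>B\<close>; for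
        \<open>k = 1\<close> the threshold \<open>s 0\<close> is minus infinity and carries no
        information.\<close>
      have "b (k - 1) < x + B" if "k \<ge> 2"
      proof -
        have "k - 1 \<in> {1..<w}" using that k by auto
        with s x(1) have "ereal (b (k - 1) - B) < ereal x" by metis
        then show ?thesis by simp
      qed
      then have "running_min (x + B)"
        using k False x(2) by (intro descending_piece[of k]) auto
      then show ?thesis
        by (intro window_min[OF xs _ _ z]) (use False in \<open>auto simp: running_min_def\<close>)
    qed
    then show ?thesis using xs B0 by (intro C_left) auto
  qed
  \<comment> \<open>The right end of the window lies between \<open>S k\<close> and
    \<open>b k\<close>, so \<open>flat_piece\<close> applies to everything in it beyond
    \<open>s\<^sub>m\<close>.\<close>
  have flat: "C x = K - v * x + G (S k)"
    if k: "k \<in> {1..<w}" and x: "S k - B < x" "ereal x \<le> s k" for k x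
  proof -
    note bk = b_greatest[OF k] and Sk = S_bounds[OF k]
    have xb: "x + B \<le> b k" using s k x(2) by auto
    have "b k < S\<^sub>m" using bk(2) S_le[of "k + 1" w] S_w k by auto
    with xb Sm(2) have xs: "x \<le> s\<^sub>m" by simp
    have "G (S k) \<le> G z" if z: "x \<le> z" "z \<le> x + B" for z
      by (rule window_min[OF xs _ _ z]) (use flat_piece[OF k] xb x Sk in auto)
    then show ?thesis using xs x Sk by (intro C_left) auto
  qed
  have last: "C x = K - v * x + G S\<^sub>m" if x: "S\<^sub>m - B < x" "x \<le> s\<^sub>m" for x
  proof -
    have "G S\<^sub>m \<le> G z" if z: "x \<le> z" "z \<le> x + B" for z
      by (rule window_min[OF x(2) _ _ z]) (use x less Sm(3) in auto)
    then show ?thesis using x less by (intro C_left) auto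
  qed
  have descending_last: "C x = K - v * x + G (x + B)" if "s (w - 1) < ereal x" "x \<le> S\<^sub>m - B" for x
    using descending[of w x] that S_w w by simp
  show ?thesis
    by (intro conjI allI ballI impI; (elim conjE)?;
        (rule C_eq C_right last flat descending_last descending; simp))
qed

end
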